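(* There exist multiple partners matching games $(N,v)$, defined on a triple $(G,b,w)$, that have a non-empty core but for which the corresponding instance $(G,b,w)$ of SFP has no stable solutions.
   Context: An instance of SFP is a triple $(G,b,w)$ where $G=(N,E)$ is a finite undirected graph without loops or multiple edges, $b:N\to\mathbb{Z}_{\ge 0}$ is a vertex capacity function, and $w:E\to\mathbb{R}_{\ge 0}$ is an edge weighting. A set $M\subseteq E$ is a $b$-matching if every $i\in N$ is incident to at most $b(i)$ edges of $M$; its weight is $w(M)=\sum_{e\in M}w(e)$. A function $p:N\times N\to\mathbb{R}_{\ge 0}$ is a payoff vector compatible with $M$ if $p(i,j)+p(j,i)=w(ij)$ for all $ij\in M$ and $p(i,j)=p(j,i)=0$ for all $ij\notin M$. A pair $(M,p)$ with $M$ a $b$-matching and $p$ a payoff vector compatible with $M$ is a solution. Define $u_p(i)=\min\{p(i,j): ij\in M\}$ if $i$ is saturated, i.e. incident with exactly $b(i)$ edges of $M$ (with $\min\emptyset=+\infty$, which occurs only if $b(i)=0$), and $u_p(i)=0$ otherwise. A solution $(M,p)$ is stable if $u_p(i)+u_p(j)\ge w(ij)$ for all $ij\in E\setminus M$. The multiple partners matching game $(N,v)$ defined on $(G,b,w)$ is the cooperative game in which, for $S\subseteq N$, $v(S)$ is the maximum weight of a $b$-matching in the induced subgraph $G[S]$ (and $0$ if $G[S]$ is edgeless). Its core is the set of $x\in\mathbb{R}^N$ with $\sum_{i\in N}x(i)=v(N)$ and $\sum_{i\in S}x(i)\ge v(S)$ for all nonempty $S\subseteq N$. *)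

theory Defs
  imports Complex_Main "HOL-Library.Extended_Real" "HOL-Library.FuncSet"
begin

text \<open>An edge between \<open>i\<close> and \<open>j\<close> is the two-element set \<open>{i, j}\<close>, so \<open>{i, i}\<close> is never an edge.
  The functions \<open>b\<close>, \<open>w\<close> and \<open>p\<close> are total, but only their values on vertices in \<open>N\<close>,
  edges in \<open>E\<close> and pairs of vertices in \<open>N\<close> matter.\<close>

definition simple_graph :: "'a set \<Rightarrow> 'a set set \<Rightarrow> bool" where
  "simple_graph N E \<longleftrightarrow> finite N \<and> (\<forall>e\<in>E. e \<subseteq> N \<and> card e = 2)"

definition sfp_instance ::
    "'a set \<Rightarrow> 'a set set \<Rightarrow> ('a \<Rightarrow> nat) \<Rightarrow> ('a set \<Rightarrow> real) \<Rightarrow> bool" where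
  "sfp_instance N E b w \<longleftrightarrow> simple_graph N E \<and> (\<forall>e\<in>E. 0 \<le> w e)"

definition incident_edges :: "'a set set \<Rightarrow> 'a \<Rightarrow> 'a set set" where
  "incident_edges M i = {e \<in> M. i \<in> e}"

definition b_matching :: "'a set \<Rightarrow> 'a set set \<Rightarrow> ('a \<Rightarrow> nat) \<Rightarrow> 'a set set \<Rightarrow> bool" where
  "b_matching N E b M \<longleftrightarrow> M \<subseteq> E \<and> (\<forall>i\<in>N. card (incident_edges M i) \<le> b i)"

definition compatible_payoff ::
    "'a set \<Rightarrow> ('a set \<Rightarrow> real) \<Rightarrow> 'a set set \<Rightarrow> ('a \<Rightarrow> 'a \<Rightarrow> real) \<Rightarrow> bool" where
  "compatible_payoff N w M p \<longleftrightarrow>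
     (\<forall>i\<in>N. \<forall>j\<in>N. 0 \<le> p i j) \<and>
     (\<forall>i\<in>N. \<forall>j\<in>N. {i, j} \<in> M \<longrightarrow> p i j + p j i = w {i, j}) \<and>
     (\<forall>i\<in>N. \<forall>j\<in>N. {i, j} \<notin> M \<longrightarrow> p i j = 0 \<and> p j i = 0)"

definition sfp_solution ::
    "'a set \<Rightarrow> 'a set set \<Rightarrow> ('a \<Rightarrow> nat) \<Rightarrow> ('a set \<Rightarrow> real) \<Rightarrow>
     'a set set \<Rightarrow> ('a \<Rightarrow> 'a \<Rightarrow> real) \<Rightarrow> bool" where
  "sfp_solution N E b w M p \<longleftrightarrow> b_matching N E b M \<and> compatible_payoff N w M p"

definition saturated :: "('a \<Rightarrow> nat) \<Rightarrow> 'a set set \<Rightarrow> 'a \<Rightarrow> bool" where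
  "saturated b M i \<longleftrightarrow> card (incident_edges M i) = b i"

text \<open>The infimum is a minimum over a finite set, or \<open>\<infinity>\<close> for a saturated vertex of capacity 0.\<close>

definition utility ::
    "('a \<Rightarrow> nat) \<Rightarrow> 'a set set \<Rightarrow> ('a \<Rightarrow> 'a \<Rightarrow> real) \<Rightarrow> 'a \<Rightarrow> ereal" where
  "utility b M p i =
     (if saturated b M i then INF j\<in>{j. {i, j} \<in> M}. ereal (p i j) else 0)"

definition stable_solution ::
    "'a set \<Rightarrow> 'a set set \<Rightarrow> ('a \<Rightarrow> nat) \<Rightarrow> ('a set \<Rightarrow> real) \<Rightarrow>
     'a set set \<Rightarrow> ('a \<Rightarrow> 'a \<Rightarrow> real) \<Rightarrow> bool" where
  "stable_solution N E b w M p \<longleftrightarrow>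
     sfp_solution N E b w M p \<and>
     (\<forall>i j. {i, j} \<in> E - M \<longrightarrow> utility b M p i + utility b M p j \<ge> ereal (w {i, j}))"

definition induced_edges :: "'a set set \<Rightarrow> 'a set \<Rightarrow> 'a set set" where
  "induced_edges E S = {e \<in> E. e \<subseteq> S}"

text \<open>Since the empty set is a \<open>b\<close>-matching, the maximum is taken over a nonempty set.\<close>

definition matching_game ::
    "'a set set \<Rightarrow> ('a \<Rightarrow> nat) \<Rightarrow> ('a set \<Rightarrow> real) \<Rightarrow> 'a set \<Rightarrow> real" where
  "matching_game E b w S = Max {sum w M |M. b_matching S (induced_edges E S) b M}"

lemma matching_game_edgeless:
  assumes "induced_edges E S = {}"
  shows "matching_game E b w S = 0"
proof -
  have "{sum w M |M. b_matching S (induced_edges E S) b M} = {0}"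
    using assms by (auto simp: b_matching_def incident_edges_def)
  then show ?thesis
    by (simp add: matching_game_def)
qed

definition core :: "'a set \<Rightarrow> ('a set \<Rightarrow> real) \<Rightarrow> ('a \<Rightarrow> real) set" where
  "core N v = {x \<in> N \<rightarrow>\<^sub>E UNIV.
     (\<Sum>i\<in>N. x i) = v N \<and> (\<forall>S. S \<subseteq> N \<and> S \<noteq> {} \<longrightarrow> (\<Sum>i\<in>S. x i) \<ge> v S)}"

end

theory Submission
  imports Defs
begin

text \<open>A stable solution is a dual certificate for the linear relaxation: its utilities and payoffs
  show that the matching weighs at least as much as every fractional \<open>b\<close>-matching (with edge
  multiplicities at most 1). A core allocation carries no such certificate, because a coalition
  cannot use a fraction of the capacity of one of its members. Take \<open>K\<^sub>4\<close> with unit weights,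
  capacity 3 at the vertex 0 and capacity 2 elsewhere. The total capacity 9 is odd, so a
  \<open>b\<close>-matching has at most 4 edges, while multiplicity 1 on the edges at 0 and 1/2 on the other
  edges has total weight 9/2; hence there is no stable solution. But the total capacity of a
  coalition \<open>S\<close> is at most \<open>2|S| + 1\<close>, so it is worth at most \<open>|S|\<close>, and giving 1 to every vertex
  is a core allocation.\<close>

lemma simple_graph_finite:
  assumes "simple_graph N E"
  shows "finite E"
proof (rule finite_subset)
  show "E \<subseteq> Pow N"
    using assms by (auto simp: simple_graph_def)
  show "finite (Pow N)"
    using assms by (simp add: simple_graph_def)
qed

text \<open>Double counting of incidences. The value may depend on both edge and endpoint and lies
  in any commutative monoid, so this serves the degree count in the naturals as well as the real
  duality estimate.\<close>

lemma sum_edges_endpoints: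
  fixes g :: "'a set \<Rightarrow> 'a \<Rightarrow> 'c::comm_monoid_add"
  assumes "simple_graph N E"
  shows "(\<Sum>e\<in>E. \<Sum>i\<in>e. g e i) = (\<Sum>i\<in>N. \<Sum>e\<in>incident_edges E i. g e i)"
proof -
  have "(\<Sum>e\<in>E. \<Sum>i\<in>e. g e i) = (\<Sum>e\<in>E. \<Sum>i\<in>{i\<in>N. i \<in> e}. g e i)"
    using assms by (intro sum.cong refl) (auto simp: simple_graph_def)
  also have "\<dots> = (\<Sum>i\<in>N. \<Sum>e\<in>{e\<in>E. i \<in> e}. g e i)"
    using assms by (intro sum.swap_restrict simple_graph_finite[OF assms])
      (auto simp: simple_graph_def)
  finally show ?thesis
    by (simp add: incident_edges_def)
qed

text \<open>Handshake argument: every edge of \<open>M\<close> uses one unit of capacity at each of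
  its two endpoints.\<close>

lemma b_matching_card_bound:
  assumes "simple_graph S E" and "b_matching S E b M"
  shows "2 * card M \<le> (\<Sum>i\<in>S. b i)"
proof -
  have M: "simple_graph S M"
    using assms by (auto simp: simple_graph_def b_matching_def)
  have "2 * card M = (\<Sum>e\<in>M. \<Sum>i\<in>e. 1)"
    using M by (simp add: simple_graph_def)
  also have "\<dots> = (\<Sum>i\<in>S. card (incident_edges M i))"
    using sum_edges_endpoints[OF M, of "\<lambda>_ _. 1::nat"] by simp
  also have "\<dots> \<le> (\<Sum>i\<in>S. b i)"
    using assms(2) by (intro sum_mono) (simp add: b_matching_def)
  finally show ?thesis .
qed

text \<open>Positive capacity gives a saturated vertex at least one partner, so its infimum is
  attained and finite. This moves the utilities from \<open>ereal\<close> to the reals, where they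
  can act as dual prices.\<close>

lemma utility_real:
  assumes "finite N" and "\<Union>M \<subseteq> N" and "0 < b i" and "\<forall>j\<in>N. 0 \<le> p i j" and "i \<in> N"
    and "\<forall>e\<in>M. card e = 2"
  obtains u where "utility b M p i = ereal u" "0 \<le> u"
    "\<And>j. {i, j} \<in> M \<Longrightarrow> u \<le> p i j" "\<not> saturated b M i \<Longrightarrow> u = 0"
proof (cases "saturated b M i")
  case True
  let ?J = "{j. {i, j} \<in> M}"
  have sub: "?J \<subseteq> N"
    using assms(2) by auto
  have fin: "finite ?J"
    using sub assms(1) by (rule finite_subset)
  have "incident_edges M i \<noteq> {}"
    using True assms(3) by (auto simp: saturated_def)
  then obtain e where "e \<in> M" "i \<in> e"
    by (auto simp: incident_edges_def)
  with assms(6) have ne: "?J \<noteq> {}"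
    by (fastforce simp: card_2_iff insert_commute)
  have "utility b M p i = Min ((\<lambda>j. ereal (p i j)) ` ?J)"
    using True fin ne by (simp add: utility_def Min_Inf)
  also have "\<dots> \<in> (\<lambda>j. ereal (p i j)) ` ?J"
    using fin ne by (intro Min_in) auto
  finally obtain k where k: "k \<in> ?J" "utility b M p i = ereal (p i k)"
    by auto
  show ?thesis
  proof (rule that[OF k(2)])
    show "0 \<le> p i k"
      using k(1) sub assms(4) by auto
    show "p i k \<le> p i j" if "{i, j} \<in> M" for j
    proof -
      have "utility b M p i \<le> ereal (p i j)"
        using True that by (auto simp: utility_def intro: INF_lower)
      then show ?thesis
        by (simp add: k(2))
    qed
  qed (use True in simp)
next
  case False
  show ?thesis
  proof (rule that[of 0])
    show "0 \<le> p i j" if "{i, j} \<in> M" for j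
      using that assms(2,4) by auto
  qed (use False in \<open>simp_all add: utility_def zero_ereal_def\<close>)
qed

text \<open>Complementary slackness: passing from the indicator \<open>m\<close> of \<open>M\<close>
  to \<open>y\<close> changes the weight by the sum of \<open>(y e - m e) * w e\<close>. Each term
  is charged to the endpoints of \<open>e\<close> at prices \<open>u\<close>, and the charges at
  every vertex sum to at most 0.\<close>

lemma stable_solution_weight_ge_fractional:
  fixes y :: "'a set \<Rightarrow> real"
  assumes G: "simple_graph N E" and st: "stable_solution N E b w M p"
    and b: "\<forall>i\<in>N. 0 < b i"
    and y: "\<forall>e\<in>E. 0 \<le> y e \<and> y e \<le> 1"
    and cap: "\<forall>i\<in>N. (\<Sum>e\<in>incident_edges E i. y e) \<le> b i"
  shows "(\<Sum>e\<in>E. y e * w e) \<le> sum w M"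
proof -
  have ME: "M \<subseteq> E"
    and deg: "\<forall>i\<in>N. card (incident_edges M i) \<le> b i"
    and pay: "compatible_payoff N w M p"
    and stable: "\<And>i j. {i, j} \<in> E - M \<Longrightarrow>
      ereal (w {i, j}) \<le> utility b M p i + utility b M p j"
    using st by (auto simp: stable_solution_def sfp_solution_def b_matching_def)
  have finE: "finite E"
    using simple_graph_finite[OF G] .
  have "\<forall>i\<in>N. \<exists>u. utility b M p i = ereal u \<and> 0 \<le> u \<and>
      (\<forall>j. {i, j} \<in> M \<longrightarrow> u \<le> p i j) \<and> (\<not> saturated b M i \<longrightarrow> u = 0)"
  proof
    fix i
    assume "i \<in> N"
    show "\<exists>u. utility b M p i = ereal u \<and> 0 \<le> u \<and>
        (\<forall>j. {i, j} \<in> M \<longrightarrow> u \<le> p i j) \<and> (\<not> saturated b M i \<longrightarrow> u = 0)"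
    proof (rule utility_real[of N M b i p])
      show "finite N" "\<Union>M \<subseteq> N" "\<forall>e\<in>M. card e = 2"
        using G ME by (auto simp: simple_graph_def)
      show "0 < b i" "\<forall>j\<in>N. 0 \<le> p i j" "i \<in> N"
        using b pay \<open>i \<in> N\<close> by (auto simp: compatible_payoff_def)
    qed blast
  qed
  then obtain u where u: "\<And>i. i \<in> N \<Longrightarrow> utility b M p i = ereal (u i)"
    "\<And>i. i \<in> N \<Longrightarrow> 0 \<le> u i"
    "\<And>i j. i \<in> N \<Longrightarrow> {i, j} \<in> M \<Longrightarrow> u i \<le> p i j"
    "\<And>i. i \<in> N \<Longrightarrow> \<not> saturated b M i \<Longrightarrow> u i = 0"
    by metis
  define m :: "'a set \<Rightarrow> real" where "m e = of_bool (e \<in> M)" for e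
  have edge: "(y e - m e) * w e \<le> (\<Sum>i\<in>e. (y e - m e) * u i)" if "e \<in> E" for e
  proof -
    have "card e = 2" "e \<subseteq> N"
      using G that by (auto simp: simple_graph_def)
    then obtain i j where e: "e = {i, j}" "i \<noteq> j" "i \<in> N" "j \<in> N"
      unfolding card_2_iff by blast
    show ?thesis
    proof (cases "e \<in> M")
      case True
      have "p i j + p j i = w e"
        using pay True e by (auto simp: compatible_payoff_def)
      moreover have "u i \<le> p i j" "u j \<le> p j i"
        using u(3) True e by (auto simp: insert_commute)
      ultimately have "u i + u j \<le> w e"
        by linarith
      \<comment> \<open>Here multiplicity at most 1 matters: the factor \<open>y e - 1\<close> is
        nonpositive and reverses the inequality.\<close>
      then have "(y e - 1) * w e \<le> (y e - 1) * (u i + u j)"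
        using y that by (intro mult_left_mono_neg) auto
      then show ?thesis
        using True e by (simp add: m_def algebra_simps)
    next
      case False
      \<comment> \<open>Outside \<open>M\<close> stability gives the opposite bound, and the factor
        \<open>y e\<close> is nonnegative.\<close>
      then have "w e \<le> u i + u j"
        using stable[of i j] u(1) e that by simp
      then have "y e * w e \<le> y e * (u i + u j)"
        using y that by (intro mult_left_mono) auto
      then show ?thesis
        using False e by (simp add: m_def algebra_simps)
    qed
  qed
  \<comment> \<open>At a saturated vertex \<open>M\<close> already uses all the capacity, so
    \<open>y\<close> cannot exceed it; at any other vertex the price is 0.\<close>
  have vertex: "(\<Sum>e\<in>incident_edges E i. (y e - m e) * u i) \<le> 0" if "i \<in> N" for i
  proof (cases "saturated b M i")
    case True
    have "{e \<in> incident_edges E i. e \<in> M} = incident_edges M i"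
      using ME by (auto simp: incident_edges_def)
    moreover have "finite (incident_edges E i)"
      using finE by (simp add: incident_edges_def)
    ultimately have "(\<Sum>e\<in>incident_edges E i. m e) = card (incident_edges M i)"
      by (simp add: m_def Int_def)
    then have "(\<Sum>e\<in>incident_edges E i. y e - m e) \<le> 0"
      using cap that True by (simp add: sum_subtractf saturated_def)
    then show ?thesis
      using u(2)[OF that] by (simp add: mult_nonpos_nonneg flip: sum_distrib_right)
  next
    case False
    then show ?thesis
      using u(4)[OF that] by simp
  qed
  have "(\<Sum>e\<in>E. m e * w e) = (\<Sum>e\<in>M. m e * w e)"
    using finE ME by (intro sum.mono_neutral_right) (auto simp: m_def)
  also have "\<dots> = sum w M"
    by (simp add: m_def)
  finally have M: "(\<Sum>e\<in>E. m e * w e) = sum w M" .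
  have "(\<Sum>e\<in>E. (y e - m e) * w e) \<le> (\<Sum>e\<in>E. \<Sum>i\<in>e. (y e - m e) * u i)"
    using edge by (rule sum_mono)
  also have "\<dots> = (\<Sum>i\<in>N. \<Sum>e\<in>incident_edges E i. (y e - m e) * u i)"
    by (rule sum_edges_endpoints[OF G])
  also have "\<dots> \<le> 0"
    using vertex by (rule sum_nonpos)
  finally show ?thesis
    by (simp add: left_diff_distrib sum_subtractf M)
qed

theorem theorem11:
  shows "\<exists>(N :: nat set) (E :: nat set set) (b :: nat \<Rightarrow> nat) (w :: nat set \<Rightarrow> real).
           sfp_instance N E b w \<and>
           core N (matching_game E b w) \<noteq> {} \<and>
           \<not> (\<exists>M p. stable_solution N E b w M p)"
proof -
  define N :: "nat set" where "N = {0, 1, 2, 3}"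
  define E :: "nat set set" where "E = {{0, 1}, {0, 2}, {0, 3}, {1, 2}, {1, 3}, {2, 3}}"
  define b :: "nat \<Rightarrow> nat" where "b = (\<lambda>i. if i = 0 then 3 else 2)"
  define w :: "nat set \<Rightarrow> real" where "w = (\<lambda>_. 1)"
  have G: "simple_graph N E"
    by (auto simp: simple_graph_def N_def E_def)
  have bound: "sum w M \<le> card S"
    if "S \<subseteq> N" "b_matching S (induced_edges E S) b M" for S M
  proof -
    have fin: "finite S"
      using that(1) by (rule finite_subset) (simp add: N_def)
    have "simple_graph S (induced_edges E S)"
      using G fin by (auto simp: simple_graph_def induced_edges_def)
    then have "2 * card M \<le> (\<Sum>i\<in>S. b i)"
      using that(2) by (rule b_matching_card_bound)
    also have "\<dots> = (\<Sum>i\<in>S. 2 + (if i = 0 then 1 else 0))"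
      by (intro sum.cong) (auto simp: b_def)
    also have "\<dots> \<le> 2 * card S + 1"
      unfolding sum.distrib using fin by simp
    \<comment> \<open>Integrality removes the extra unit: an even number that is at most
      \<open>2 * card S + 1\<close> is at most \<open>2 * card S\<close>.\<close>
    finally show ?thesis
      by (simp add: w_def)
  qed
  have fin: "finite {sum w M |M. b_matching S (induced_edges E S) b M}" for S
  proof -
    have "{sum w M |M. b_matching S (induced_edges E S) b M} \<subseteq> sum w ` Pow E"
      by (auto simp: b_matching_def induced_edges_def)
    moreover have "finite (sum w ` Pow E)"
      using simple_graph_finite[OF G] by simp
    ultimately show ?thesis
      by (rule finite_subset)
  qed
  have game_le: "matching_game E b w S \<le> card S" if "S \<subseteq> N" for S
    unfolding matching_game_def
  proof (rule Max.boundedI[OF fin])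
    have "b_matching S (induced_edges E S) b {}"
      by (simp add: b_matching_def incident_edges_def)
    then show "{sum w M |M. b_matching S (induced_edges E S) b M} \<noteq> {}"
      by blast
  qed (use bound[OF that] in auto)
  have game_ge: "4 \<le> matching_game E b w N"
  proof -
    \<comment> \<open>The star at 0 plus one edge uses 8 of the 9 units of capacity; only vertex 3
      keeps a spare unit.\<close>
    let ?M = "{{0, 1}, {0, 2}, {0, 3}, {1, 2}} :: nat set set"
    have "incident_edges ?M 0 = {{0, 1}, {0, 2}, {0, 3}}"
      "incident_edges ?M 1 = {{0, 1}, {1, 2}}"
      "incident_edges ?M 2 = {{0, 2}, {1, 2}}"
      "incident_edges ?M 3 = {{0, 3}}"
      by (auto simp: incident_edges_def)
    then have "\<forall>i\<in>N. card (incident_edges ?M i) \<le> b i"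
      by (simp add: N_def b_def doubleton_eq_iff)
    moreover have "?M \<subseteq> induced_edges E N"
      by (auto simp: induced_edges_def E_def N_def)
    ultimately have "b_matching N (induced_edges E N) b ?M"
      by (simp add: b_matching_def)
    then have "sum w ?M \<le> matching_game E b w N"
      unfolding matching_game_def by (intro Max_ge[OF fin]) blast
    then show ?thesis
      by (simp add: w_def doubleton_eq_iff)
  qed
  \<comment> \<open>The allocation is restricted to \<open>N\<close> because \<open>core\<close>
    contains only extensional functions.\<close>
  have "(\<lambda>i\<in>N. 1) \<in> core N (matching_game E b w)"
    unfolding core_def
  proof (intro CollectI conjI allI impI)
    show "(\<Sum>i\<in>N. (\<lambda>i\<in>N. 1) i) = matching_game E b w N"
      using game_ge game_le[of N] by (simp add: N_def)
    show "matching_game E b w S \<le> (\<Sum>i\<in>S. (\<lambda>i\<in>N. 1) i)" if "S \<subseteq> N \<and> S \<noteq> {}" for S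
    proof -
      have "(\<Sum>i\<in>S. (\<lambda>i\<in>N. 1 :: real) i) = (\<Sum>i\<in>S. 1)"
        using that by (intro sum.cong) auto
      then show ?thesis
        using game_le[of S] that by simp
    qed
  qed auto
  moreover have "\<not> stable_solution N E b w M p" for M p
  proof
    assume st: "stable_solution N E b w M p"
    \<comment> \<open>These multiplicities exhaust every capacity: 1 + 1 + 1 at vertex 0 and 1 + 1/2
      + 1/2 at the others. The total weight is therefore half of 9, beyond the integral bound
      4.\<close>
    define y :: "nat set \<Rightarrow> real" where "y e = (if 0 \<in> e then 1 else 1/2)" for e
    have "incident_edges E 0 = {{0, 1}, {0, 2}, {0, 3}}"
      "incident_edges E 1 = {{0, 1}, {1, 2}, {1, 3}}"
      "incident_edges E 2 = {{0, 2}, {1, 2}, {2, 3}}"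
      "incident_edges E 3 = {{0, 3}, {1, 3}, {2, 3}}"
      by (auto simp: incident_edges_def E_def)
    then have cap: "\<forall>i\<in>N. (\<Sum>e\<in>incident_edges E i. y e) \<le> b i"
      by (simp add: N_def y_def b_def doubleton_eq_iff)
    have "(\<Sum>e\<in>E. y e * w e) \<le> sum w M"
      using G st _ _ cap
      by (rule stable_solution_weight_ge_fractional) (auto simp: b_def y_def)
    moreover have "(\<Sum>e\<in>E. y e * w e) = 9/2"
      by (simp add: E_def y_def w_def doubleton_eq_iff)
    moreover have "induced_edges E N = E"
      using G by (auto simp: induced_edges_def simple_graph_def)
    then have "sum w M \<le> card N"
      using st by (intro bound) (auto simp: stable_solution_def sfp_solution_def)
    ultimately show False
      by (simp add: N_def)
  qed
  moreover have "sfp_instance N E b w"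
    using G by (simp add: sfp_instance_def w_def)
  ultimately show ?thesis
    by blast
qed

end
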